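(* Let $p>1$, $\lambda_1\le0$, $\lambda_2<0$ and $Z>0$. Then for all $\omega<0$ satisfying $$-\frac{p\lambda_1^2}{(p+1)^2\lambda_2}<-\omega<\frac{Z^2}{4},$$ the standing wave $u(x,t)=e^{-i\omega t}\phi_\omega(x)$, with $\phi_\omega$ defined in the context, is a solution of $$iu_t+u_{xx}+Z\delta(x)u+\lambda_1u|u|^{p-1}+\lambda_2u|u|^{2p-2}=0,\qquad t,x\in\mathbb{R}.$$
   Context: $\delta$ is the Dirac distribution at the origin. The operator $-\partial_{xx}-Z\delta(x)$ is the self-adjoint operator $A_Z$ on $L^2(\mathbb{R})$ with $A_Zf=-f''$ for $x\ne0$ and domain $D(A_Z)=\{f\in H^1(\mathbb{R})\cap H^2(\mathbb{R}\setminus\{0\}): f'(0+)-f'(0-)=-Zf(0)\}$. That $e^{-i\omega t}\phi_\omega$ solves the equation means that $\phi_\omega\in D(A_Z)$ and $$A_Z\phi_\omega-\omega\phi_\omega-\lambda_1\phi_\omega|\phi_\omega|^{p-1}-\lambda_2\phi_\omega|\phi_\omega|^{2p-2}=0,$$ i.e. $\phi_\omega''+\omega\phi_\omega+\lambda_1\phi_\omega|\phi_\omega|^{p-1}+\lambda_2\phi_\omega|\phi_\omega|^{2p-2}=0$ for $x\neq0$ together with $\phi_\omega'(0+)-\phi_\omega'(0-)=-Z\phi_\omega(0)$. Profile: put $\alpha=\frac{\lambda_1}{p+1}$, $\beta=\frac{\lambda_2}{p}$ (so $\omega\beta-\alpha^2>0$), and $l=\frac{1}{(p-1)\sqrt{-\omega}}\sinh^{-1}\!\left(\frac{\alpha}{\sqrt{\omega\beta-\alpha^2}}\right)\le0$.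 Let $R_1:(-l,\infty)\to(1,\infty)$ be the (decreasing) diffeomorphism $$R_1(d)=\frac{\sqrt{\omega\beta-\alpha^2}\cosh((p-1)\sqrt{-\omega}\,d)}{\sqrt{\omega\beta-\alpha^2}\sinh((p-1)\sqrt{-\omega}\,d)+\alpha}.$$ Then $$\phi_\omega(x)=\left[\frac{\alpha}{-\omega}+\frac{\sqrt{\omega\beta-\alpha^2}}{-\omega}\sinh\!\left((p-1)\sqrt{-\omega}\left(|x|+R_1^{-1}\!\left(\tfrac{Z}{2\sqrt{-\omega}}\right)\right)\right)\right]^{-\frac{1}{p-1}}.$$ *)

theory Defs
  imports "HOL-Analysis.Analysis"
begin

text \<open>Elements of Lebesgue and Sobolev spaces are represented by Borel functions on the
  whole real line. The function spaces, the operator and its domain do not distinguish Borel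
  functions that agree almost everywhere.\<close>

definition L2_space :: "real set \<Rightarrow> (real \<Rightarrow> complex) set" where
  "L2_space \<Omega> = {f. set_borel_measurable lborel \<Omega> f \<and>
                     set_integrable lborel \<Omega> (\<lambda>x. (cmod (f x))\<^sup>2)}"

definition test_function :: "real set \<Rightarrow> (real \<Rightarrow> real) \<Rightarrow> bool" where
  "test_function \<Omega> \<psi> \<longleftrightarrow>
     (\<forall>n x. (deriv ^^ n) \<psi> field_differentiable (at x)) \<and>
     (\<exists>K. compact K \<and> K \<subseteq> \<Omega> \<and> (\<forall>x. x \<notin> K \<longrightarrow> \<psi> x = 0))"

text \<open>Real-valued test functions suffice, since the identity is linear in the test function.
  The relation is only used for \<open>f\<close> and \<open>g\<close> in \<open>L2_space \<Omega>\<close>, so that both integrals exist.\<close>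

definition weak_derivative :: "real set \<Rightarrow> (real \<Rightarrow> complex) \<Rightarrow> (real \<Rightarrow> complex) \<Rightarrow> bool" where
  "weak_derivative \<Omega> f g \<longleftrightarrow>
     (\<forall>\<psi>. test_function \<Omega> \<psi> \<longrightarrow>
        (LINT x:\<Omega>|lborel. deriv \<psi> x *\<^sub>R f x) = - (LINT x:\<Omega>|lborel. \<psi> x *\<^sub>R g x))"

primrec sobolev_H :: "nat \<Rightarrow> real set \<Rightarrow> (real \<Rightarrow> complex) set" where
  "sobolev_H 0 \<Omega> = L2_space \<Omega>"
| "sobolev_H (Suc k) \<Omega> = {f \<in> L2_space \<Omega>. \<exists>g \<in> sobolev_H k \<Omega>. weak_derivative \<Omega> f g}"

text \<open>The jump condition \<open>f'(0+) - f'(0-) = -Z f(0)\<close> refers to the continuous representative \<open>F\<close>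
  of \<open>f\<close>. It exists and is unique for \<open>f\<close> in \<open>H\<^sup>1(\<real>)\<close>, and it is continuously differentiable off
  the origin for \<open>f\<close> in \<open>H\<^sup>2(\<real> - {0})\<close>, so \<open>vector_derivative\<close> is the genuine derivative there.\<close>

definition delta_jump_condition :: "real \<Rightarrow> (real \<Rightarrow> complex) \<Rightarrow> bool" where
  "delta_jump_condition Z f \<longleftrightarrow>
     (\<exists>F a b. continuous_on UNIV F \<and> (AE x in lborel. f x = F x) \<and>
        ((\<lambda>x. vector_derivative F (at x)) \<longlongrightarrow> a) (at_right 0) \<and>
        ((\<lambda>x. vector_derivative F (at x)) \<longlongrightarrow> b) (at_left 0) \<and>
        a - b = - complex_of_real Z * F 0)"

definition delta_domain :: "real \<Rightarrow> (real \<Rightarrow> complex) set" where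
  "delta_domain Z = {f \<in> sobolev_H 1 UNIV \<inter> sobolev_H 2 (- {0}). delta_jump_condition Z f}"

text \<open>The unbounded operator \<open>A\<^sub>Z = -\<partial>\<^sub>x\<^sub>x - Z \<delta>(x)\<close>, given by its graph:
  \<open>delta_operator Z f h\<close> says that \<open>f \<in> D(A\<^sub>Z)\<close> and that \<open>h\<close> represents \<open>A\<^sub>Z f\<close>, i.e. \<open>-h\<close> is
  the second weak derivative of \<open>f\<close> on the complement of the origin.\<close>

definition delta_operator :: "real \<Rightarrow> (real \<Rightarrow> complex) \<Rightarrow> (real \<Rightarrow> complex) \<Rightarrow> bool" where
  "delta_operator Z f h \<longleftrightarrow>
     f \<in> delta_domain Z \<and> h \<in> L2_space UNIV \<and>
     (\<exists>g \<in> L2_space (- {0}).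
        weak_derivative (- {0}) f g \<and> weak_derivative (- {0}) g (\<lambda>x. - h x))"

definition stationary_solution ::
    "real \<Rightarrow> real \<Rightarrow> real \<Rightarrow> real \<Rightarrow> real \<Rightarrow> (real \<Rightarrow> complex) \<Rightarrow> bool" where
  "stationary_solution Z p lam1 lam2 \<omega> \<phi> \<longleftrightarrow>
     (\<exists>h. delta_operator Z \<phi> h \<and>
        (AE x in lborel. h x - of_real \<omega> * \<phi> x
            - of_real lam1 * \<phi> x * of_real (cmod (\<phi> x) powr (p - 1))
            - of_real lam2 * \<phi> x * of_real (cmod (\<phi> x) powr (2 * p - 2)) = 0))"

text \<open>\<open>u\<close> is a standing wave of frequency \<open>\<omega>\<close> that solves
  \<open>i u\<^sub>t + u\<^sub>x\<^sub>x + Z \<delta>(x) u + lam1 u |u|\<^bsup>p-1\<^esup> + lam2 u |u|\<^bsup>2p-2\<^esup> = 0\<close>; by definition this means that its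
  (unique) profile solves the stationary equation.\<close>

definition standing_wave_solution ::
    "real \<Rightarrow> real \<Rightarrow> real \<Rightarrow> real \<Rightarrow> real \<Rightarrow> (real \<Rightarrow> real \<Rightarrow> complex) \<Rightarrow> bool" where
  "standing_wave_solution Z p lam1 lam2 \<omega> u \<longleftrightarrow>
     (\<exists>\<phi>. (\<forall>x t. u x t = exp (- \<i> * of_real \<omega> * of_real t) * \<phi> x) \<and>
          stationary_solution Z p lam1 lam2 \<omega> \<phi>)"

definition alpha_coeff :: "real \<Rightarrow> real \<Rightarrow> real" where
  "alpha_coeff p lam1 = lam1 / (p + 1)"

definition beta_coeff :: "real \<Rightarrow> real \<Rightarrow> real" where
  "beta_coeff p lam2 = lam2 / p"

definition sqrt_discr :: "real \<Rightarrow> real \<Rightarrow> real \<Rightarrow> real \<Rightarrow> real" where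
  "sqrt_discr p lam1 lam2 \<omega> = sqrt (\<omega> * beta_coeff p lam2 - (alpha_coeff p lam1)\<^sup>2)"

definition l_shift :: "real \<Rightarrow> real \<Rightarrow> real \<Rightarrow> real \<Rightarrow> real" where
  "l_shift p lam1 lam2 \<omega> =
     1 / ((p - 1) * sqrt (- \<omega>)) * arsinh (alpha_coeff p lam1 / sqrt_discr p lam1 lam2 \<omega>)"

definition R1 :: "real \<Rightarrow> real \<Rightarrow> real \<Rightarrow> real \<Rightarrow> real \<Rightarrow> real" where
  "R1 p lam1 lam2 \<omega> d =
     sqrt_discr p lam1 lam2 \<omega> * cosh ((p - 1) * sqrt (- \<omega>) * d) /
     (sqrt_discr p lam1 lam2 \<omega> * sinh ((p - 1) * sqrt (- \<omega>) * d) + alpha_coeff p lam1)"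

text \<open>The inverse is that of \<open>R1\<close> restricted to \<open>(-l, \<infinity>)\<close>, which it maps bijectively onto
  \<open>(1, \<infinity>)\<close>.\<close>

definition profile :: "real \<Rightarrow> real \<Rightarrow> real \<Rightarrow> real \<Rightarrow> real \<Rightarrow> real \<Rightarrow> real" where
  "profile Z p lam1 lam2 \<omega> x =
     (alpha_coeff p lam1 / (- \<omega>) +
      sqrt_discr p lam1 lam2 \<omega> / (- \<omega>) *
        sinh ((p - 1) * sqrt (- \<omega>) *
          (\<bar>x\<bar> + inv_into {- l_shift p lam1 lam2 \<omega> <..} (R1 p lam1 lam2 \<omega>) (Z / (2 * sqrt (- \<omega>))))))
     powr (- (1 / (p - 1)))"

end

theory Submission
  imports Defs
begin

text \<open>Write the profile as \<open>V(|x|)\<^bsup>-q\<^esup>\<close> with \<open>q = 1/(p-1)\<close>, \<open>V(y) = a + b sinh (k(y+d))\<close> and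
  \<open>k = (p-1) m\<close>, \<open>m\<^sup>2 = -\<omega>\<close>. Since \<open>V'\<^sup>2 = k\<^sup>2 (b\<^sup>2 + (V-a)\<^sup>2)\<close> and \<open>V'' = k\<^sup>2 (V-a)\<close>, the second derivative of
  \<open>V\<^bsup>-q\<^esup>\<close> is a combination of \<open>V\<^bsup>-q\<^esup>\<close>, \<open>V\<^bsup>-q-1\<^esup>\<close>, \<open>V\<^bsup>-q-2\<^esup>\<close>, which are the three powers of the
  profile in the stationary equation. The jump condition for an even function is a condition on the
  logarithmic derivative at \<open>0+\<close>, which says exactly that \<open>d\<close> is the preimage of \<open>Z/(2m) > 1\<close>
  under \<open>R\<^sub>1\<close>. As \<open>V\<close> grows at least like \<open>exp (ky)\<close>, the profile and its derivatives are
  \<open>O(exp (-m|x|))\<close>, hence square integrable, and piecewise classical derivatives of such functions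
  are weak derivatives.\<close>

section \<open>Classical derivatives as weak derivatives\<close>

lemma set_integrable_compact_support_scaleR_L2:
  fixes f :: "real \<Rightarrow> complex" and \<eta> :: "real \<Rightarrow> real"
  assumes [measurable]: "\<Omega> \<in> sets borel" and f: "f \<in> L2_space \<Omega>"
    and \<eta>: "continuous_on UNIV \<eta>" and K: "compact K" "\<And>x. x \<notin> K \<Longrightarrow> \<eta> x = 0"
  shows "set_integrable lborel \<Omega> (\<lambda>x. \<eta> x *\<^sub>R f x)"
proof (rule set_integrable_bound)
  have "integrable lborel (\<lambda>x. indicator K x *\<^sub>R (\<eta> x)\<^sup>2)"
    using \<eta> by (intro borel_integrable_compact K continuous_intros) (auto intro: continuous_on_subset)
  also have "(\<lambda>x. indicator K x *\<^sub>R (\<eta> x)\<^sup>2) = (\<lambda>x. (\<eta> x)\<^sup>2)"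
    by (rule ext) (use K(2) in \<open>auto simp: indicator_def\<close>)
  finally have "set_integrable lborel \<Omega> (\<lambda>x. (\<eta> x)\<^sup>2)"
    unfolding set_integrable_def by (intro integrable_mult_indicator) auto
  \<comment> \<open>The dominating function comes from the inequality between arithmetic and
    geometric mean, so only square integrability of \<open>f\<close> enters.\<close>
  then show "set_integrable lborel \<Omega> (\<lambda>x. (\<eta> x)\<^sup>2 + (cmod (f x))\<^sup>2)"
    using f by (intro set_integral_add) (auto simp: L2_space_def)
  have [measurable]: "\<eta> \<in> borel_measurable borel"
    using \<eta> by (rule borel_measurable_continuous_onI)
  have [measurable]: "(\<lambda>x. indicator \<Omega> x *\<^sub>R f x) \<in> borel_measurable borel"
    using f by (simp add: L2_space_def set_borel_measurable_def)
  have "(\<lambda>x. \<eta> x *\<^sub>R (indicator \<Omega> x *\<^sub>R f x)) \<in> borel_measurable borel"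
    by measurable
  then show "set_borel_measurable lborel \<Omega> (\<lambda>x. \<eta> x *\<^sub>R f x)"
    by (simp add: set_borel_measurable_def mult.commute)
  have "norm (\<eta> x *\<^sub>R f x) \<le> norm ((\<eta> x)\<^sup>2 + (cmod (f x))\<^sup>2)" for x
  proof -
    have "2 * \<bar>\<eta> x\<bar> * cmod (f x) \<le> (\<eta> x)\<^sup>2 + (cmod (f x))\<^sup>2"
      using sum_squares_bound[of "\<bar>\<eta> x\<bar>" "cmod (f x)"] by simp
    moreover have "0 \<le> \<bar>\<eta> x\<bar> * cmod (f x)" by simp
    ultimately have "\<bar>\<eta> x\<bar> * cmod (f x) \<le> (\<eta> x)\<^sup>2 + (cmod (f x))\<^sup>2" by linarith
    then show ?thesis by simp
  qed
  then show "AE x in lborel. x \<in> \<Omega> \<longrightarrow> norm (\<eta> x *\<^sub>R f x) \<le> norm ((\<eta> x)\<^sup>2 + (cmod (f x))\<^sup>2)"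
    by simp
qed

lemma has_vector_derivative_zero_outside_compact:
  fixes F :: "real \<Rightarrow> 'a :: real_normed_vector"
  assumes "compact K" "\<And>x. x \<notin> K \<Longrightarrow> F x = 0" "x \<notin> K"
  shows "(F has_vector_derivative 0) (at x)"
  by (rule has_vector_derivative_transform_within_open[where f = "\<lambda>_. 0" and S = "- K"])
     (use assms in \<open>auto simp: compact_imp_closed open_Compl\<close>)

text \<open>Integration by parts: the derivative of \<open>\<psi> x *\<^sub>R f x\<close> integrates
  to zero over an interval around the support of \<open>\<psi>\<close>. The fundamental theorem
  tolerates finitely many points without derivative if the function is continuous there;
  \<open>S\<close> thus admits a kink of \<open>f\<close> inside \<Omega>.\<close>

lemma weak_derivativeI:
  fixes f g :: "real \<Rightarrow> complex"
  assumes \<Omega>: "open \<Omega>" and S: "finite S"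
    and f: "f \<in> L2_space \<Omega>" and g: "g \<in> L2_space \<Omega>" and cont: "continuous_on \<Omega> f"
    and deriv: "\<And>x. x \<in> \<Omega> - S \<Longrightarrow> (f has_vector_derivative g x) (at x)"
  shows "weak_derivative \<Omega> f g"
  unfolding weak_derivative_def
proof (intro allI impI)
  fix \<psi> assume "test_function \<Omega> \<psi>"
  then obtain K where K: "compact K" "K \<subseteq> \<Omega>" "\<And>x. x \<notin> K \<Longrightarrow> \<psi> x = 0"
    and smooth: "\<And>n x. (deriv ^^ n) \<psi> field_differentiable (at x)"
    unfolding test_function_def by blast
  have D: "(\<psi> has_real_derivative deriv \<psi> x) (at x)" for x
    using smooth[of 0 x] by (simp add: DERIV_deriv_iff_field_differentiable)
  have contD: "continuous_on UNIV (deriv \<psi>)"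
    using smooth[of 1]
    by (auto intro!: continuous_at_imp_continuous_on field_differentiable_imp_continuous_at)
  have cont\<psi>: "continuous_on UNIV \<psi>"
    using D by (auto intro!: continuous_at_imp_continuous_on DERIV_isCont)
  have D0: "deriv \<psi> x = 0" if "x \<notin> K" for x
    using has_vector_derivative_zero_outside_compact[OF K(1,3) that]
    by (simp add: DERIV_imp_deriv has_real_derivative_iff_has_vector_derivative)
  define F where "F x = \<psi> x *\<^sub>R f x" for x
  define F' where "F' x = deriv \<psi> x *\<^sub>R f x + \<psi> x *\<^sub>R g x" for x
  have F0: "F x = 0" "F' x = 0" if "x \<notin> K" for x
    using that K(3) D0 by (auto simp: F_def F'_def)
  have zero: "(F has_vector_derivative 0) (at x)" if "x \<notin> K" for x
    using K(1) F0(1) that by (rule has_vector_derivative_zero_outside_compact)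
  have F': "(F has_vector_derivative F' x) (at x)" if "x \<notin> S" for x
  proof (cases "x \<in> K")
    case True
    then have "(f has_vector_derivative g x) (at x)" using deriv K that by blast
    with D[of x] have "(F has_vector_derivative (\<psi> x *\<^sub>R g x + deriv \<psi> x *\<^sub>R f x)) (at x)"
      unfolding F_def by (intro has_vector_derivative_scaleR)
    then show ?thesis by (simp add: F'_def add.commute)
  next
    case False
    then show ?thesis using zero F0 by simp
  qed
  \<comment> \<open>Continuity holds on the whole line: \<open>F\<close> vanishes near every point
    off \<open>K\<close>, whatever \<open>f\<close> does outside \<Omega>.\<close>
  have "isCont F x" for x
  proof (cases "x \<in> K")
    case True
    then have "isCont f x" using K(2) cont \<Omega> continuous_on_eq_continuous_at by blast
    moreover have "isCont \<psi> x" using D DERIV_isCont by blast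
    ultimately show ?thesis unfolding F_def by (intro continuous_intros)
  next
    case False
    then show ?thesis using zero has_vector_derivative_continuous by blast
  qed
  then have contF: "continuous_on A F" for A by (simp add: continuous_at_imp_continuous_on)
  \<comment> \<open>\<open>K\<close> lies strictly inside the interval, so the boundary terms at
    \<open>M\<close> and \<open>- M\<close> vanish.\<close>
  obtain M where M: "M > 0" "\<And>x. x \<in> K \<Longrightarrow> \<bar>x\<bar> < M"
    using compact_imp_bounded[OF K(1)] by (auto simp: bounded_pos_less)
  have M_out: "M \<notin> K" "- M \<notin> K" using M by force+
  have "(F' has_integral (F M - F (- M))) {-M..M}"
    by (rule fundamental_theorem_of_calculus_interior_strong[OF S])
       (use M F' contF in auto)
  then have "(F' has_integral 0) {-M..M}" using M_out F0 by simp
  then have "(F' has_integral 0) UNIV"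
    by (rule has_integral_on_superset) (use M F0 in force)+
  moreover have m: "\<Omega> \<in> sets borel" using \<Omega> by simp
  have i1: "set_integrable lborel \<Omega> (\<lambda>x. deriv \<psi> x *\<^sub>R f x)"
    by (rule set_integrable_compact_support_scaleR_L2[OF m f contD K(1) D0])
  have i2: "set_integrable lborel \<Omega> (\<lambda>x. \<psi> x *\<^sub>R g x)"
    by (rule set_integrable_compact_support_scaleR_L2[OF m g cont\<psi> K(1,3)])
  have eq: "(\<lambda>x. indicator \<Omega> x *\<^sub>R F' x) = F'"
    using F0 K(2) by (force simp: indicator_def)
  \<comment> \<open>The fundamental theorem gave a gauge integral. Both summands of
    \<open>F'\<close> are Lebesgue integrable, so the two integrals agree and the Lebesgue integral
    is zero.\<close>
  have "(F' has_integral (LINT x:\<Omega>|lborel. F' x)) UNIV"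
    using set_integral_add(1)[OF i1 i2] has_integral_integral_lborel[of F'] eq
    by (simp add: set_integrable_def set_lebesgue_integral_def F'_def)
  ultimately have "(LINT x:\<Omega>|lborel. F' x) = 0"
    using has_integral_unique by blast
  then show "(LINT x:\<Omega>|lborel. deriv \<psi> x *\<^sub>R f x) = - (LINT x:\<Omega>|lborel. \<psi> x *\<^sub>R g x)"
    using set_integral_add(2)[OF i1 i2] by (simp add: F'_def eq_neg_iff_add_eq_0)
qed

section \<open>Exponential decay and square integrability\<close>

lemma integrable_exp_minus_abs:
  fixes a :: real
  assumes "a > 0"
  shows "integrable lborel (\<lambda>x. exp (- a * \<bar>x\<bar>))"
proof -
  have "set_integrable lebesgue {0..} (\<lambda>x. exp (- a * x))"
    using assms by (intro nonnegative_absolutely_integrable_1 integrable_on_exp_minus_to_infinity) auto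
  \<comment> \<open>The integrand is Borel measurable, so integrability passes from Lebesgue measure
    to \<open>lborel\<close>; evenness then supplies the negative half-line.\<close>
  then have "integrable lborel (\<lambda>x. indicator {0..} x *\<^sub>R exp (- a * x))"
    unfolding set_integrable_def by (subst (asm) integrable_completion) auto
  also have "(\<lambda>x. indicator {0..} x *\<^sub>R exp (- a * x)) = (\<lambda>x. indicator {0..} x *\<^sub>R exp (- a * \<bar>x\<bar>))"
    by (auto simp: indicator_def)
  finally show ?thesis
    using has_bochner_integral_even_function[of "\<lambda>x. exp (- a * \<bar>x\<bar>)"]
    by (auto simp: has_bochner_integral_iff)
qed

lemma L2_space_exp_decay:
  fixes f :: "real \<Rightarrow> complex"
  assumes [measurable]: "f \<in> borel_measurable borel" "\<Omega> \<in> sets borel"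
    and "m > 0" and bound: "\<And>x. cmod (f x) \<le> C * exp (- m * \<bar>x\<bar>)"
  shows "f \<in> L2_space \<Omega>"
proof -
  have "integrable lborel (\<lambda>x. C\<^sup>2 * exp (- (2 * m) * \<bar>x\<bar>))"
    using integrable_exp_minus_abs[of "2 * m"] \<open>m > 0\<close> by simp
  then have "integrable lborel (\<lambda>x. (cmod (f x))\<^sup>2)"
  proof (rule Bochner_Integration.integrable_bound)
    have "(cmod (f x))\<^sup>2 \<le> C\<^sup>2 * exp (- (2 * m) * \<bar>x\<bar>)" for x
      using power_mono[OF bound[of x], of 2]
      by (simp add: power_mult_distrib exp_double[symmetric] ac_simps)
    then show "AE x in lborel. norm ((cmod (f x))\<^sup>2) \<le> norm (C\<^sup>2 * exp (- (2 * m) * \<bar>x\<bar>))"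
      by simp
  qed measurable
  then show ?thesis
    using integrable_mult_indicator[of \<Omega> lborel "\<lambda>x. (cmod (f x))\<^sup>2"]
    by (auto simp: L2_space_def set_borel_measurable_def set_integrable_def)
qed

section \<open>Even and odd extensions from the half-line, and the operator on even
  functions\<close>

lemma has_real_derivative_abs:
  fixes x :: real
  assumes "x \<noteq> 0"
  shows "(abs has_real_derivative sgn x) (at x)"
proof -
  have "((\<lambda>y. sgn x * y) has_real_derivative sgn x) (at x)"
    by (auto intro!: derivative_eq_intros)
  \<comment> \<open>These are the points with the sign of \<open>x\<close>: an open neighbourhood of
    \<open>x\<close> on which \<open>abs\<close> is linear.\<close>
  moreover have "open {y. 0 < x * y}"
    by (intro open_Collect_less continuous_intros)
  ultimately show ?thesis
    by (rule has_field_derivative_transform_within_open)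
       (use assms in \<open>auto simp: sgn_if zero_less_mult_iff\<close>)
qed

lemma has_real_derivative_even_extension:
  fixes \<Phi> :: "real \<Rightarrow> real"
  assumes "x \<noteq> 0" "(\<Phi> has_real_derivative D) (at \<bar>x\<bar>)"
  shows "((\<lambda>x. \<Phi> \<bar>x\<bar>) has_real_derivative sgn x * D) (at x)"
  using DERIV_chain2[OF assms(2) has_real_derivative_abs[OF assms(1)]] by (simp add: mult.commute)

lemma has_real_derivative_odd_extension:
  fixes \<Psi> :: "real \<Rightarrow> real"
  assumes "x \<noteq> 0" "(\<Psi> has_real_derivative D) (at \<bar>x\<bar>)"
  shows "((\<lambda>x. sgn x * \<Psi> \<bar>x\<bar>) has_real_derivative D) (at x)"
proof -
  have "((\<lambda>y. sgn x * \<Psi> \<bar>y\<bar>) has_real_derivative sgn x * (sgn x * D)) (at x)"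
    by (intro DERIV_cmult has_real_derivative_even_extension assms)
  also have "sgn x * (sgn x * D) = D" using assms(1) by (simp add: sgn_if)
  finally have "((\<lambda>y. sgn x * \<Psi> \<bar>y\<bar>) has_real_derivative D) (at x)" .
  moreover have "open {y. 0 < x * y}"
    by (intro open_Collect_less continuous_intros)
  ultimately show ?thesis
    by (rule has_field_derivative_transform_within_open)
       (use assms in \<open>auto simp: sgn_if zero_less_mult_iff\<close>)
qed

lemma continuous_on_even_extension:
  fixes X :: "real \<Rightarrow> real"
  assumes "continuous_on {0..} X"
  shows "continuous_on UNIV (\<lambda>x. X \<bar>x\<bar>)"
  by (rule continuous_on_compose2[OF assms]) (auto intro: continuous_intros)

text \<open>Reduces the operator to data on the half-line. The derivative of the even extension of
  \<Phi> is the odd extension of \<Psi>, which jumps by \<open>2 * \<Psi> 0\<close> at the origin,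
  and the second derivative is the even extension of \<open>X\<close>. The decay bounds put all
  three in L2.\<close>

lemma delta_operator_even_extension:
  fixes \<Phi> \<Psi> X :: "real \<Rightarrow> real"
  assumes \<Phi>: "\<And>y. y \<ge> 0 \<Longrightarrow> (\<Phi> has_real_derivative \<Psi> y) (at y)"
    and \<Psi>: "\<And>y. y \<ge> 0 \<Longrightarrow> (\<Psi> has_real_derivative X y) (at y)"
    and X: "continuous_on {0..} X"
    and m: "m > 0"
    and decay: "\<And>y. y \<ge> 0 \<Longrightarrow> \<bar>\<Phi> y\<bar> \<le> A * exp (- m * y)"
      "\<And>y. y \<ge> 0 \<Longrightarrow> \<bar>\<Psi> y\<bar> \<le> B * exp (- m * y)"
      "\<And>y. y \<ge> 0 \<Longrightarrow> \<bar>X y\<bar> \<le> C * exp (- m * y)"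
    and jump: "2 * \<Psi> 0 = - Z * \<Phi> 0"
  shows "delta_operator Z (\<lambda>x. of_real (\<Phi> \<bar>x\<bar>)) (\<lambda>x. of_real (- X \<bar>x\<bar>))"
proof -
  define f :: "real \<Rightarrow> complex" where "f x = of_real (\<Phi> \<bar>x\<bar>)" for x
  define g :: "real \<Rightarrow> complex" where "g x = of_real (sgn x * \<Psi> \<bar>x\<bar>)" for x
  define h :: "real \<Rightarrow> complex" where "h x = of_real (- X \<bar>x\<bar>)" for x
  have cont: "continuous_on UNIV (\<lambda>x. \<Phi> \<bar>x\<bar>)" "continuous_on UNIV (\<lambda>x. \<Psi> \<bar>x\<bar>)"
    using \<Phi> \<Psi>
    by (intro continuous_on_even_extension continuous_at_imp_continuous_on ballI DERIV_isCont; force)+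
  note contX = continuous_on_even_extension[OF X]
  have contf: "continuous_on UNIV f"
    unfolding f_def by (intro continuous_on_of_real cont)
  have [measurable]: "(\<lambda>x. \<Psi> \<bar>x\<bar>) \<in> borel_measurable borel" "(\<lambda>x. X \<bar>x\<bar>) \<in> borel_measurable borel"
    "(\<lambda>x. \<Phi> \<bar>x\<bar>) \<in> borel_measurable borel"
    using cont contX by (auto intro: borel_measurable_continuous_onI)
  have [measurable]: "f \<in> borel_measurable borel" "g \<in> borel_measurable borel" "h \<in> borel_measurable borel"
    unfolding f_def g_def h_def by measurable
  have f: "f \<in> L2_space \<Omega>" if [measurable]: "\<Omega> \<in> sets borel" for \<Omega>
  proof (rule L2_space_exp_decay[OF _ that m])
    show "cmod (f x) \<le> A * exp (- m * \<bar>x\<bar>)" for x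
      using decay(1) by (simp add: f_def)
  qed measurable
  \<comment> \<open>Since \<open>sgn 0 = 0\<close>, the bound for \<open>g\<close> at the origin
    reads \<open>0 \<le> B\<close>.\<close>
  have B: "0 \<le> B" using order_trans[OF abs_ge_zero decay(2)[of 0]] by simp
  have g: "g \<in> L2_space \<Omega>" if [measurable]: "\<Omega> \<in> sets borel" for \<Omega>
  proof (rule L2_space_exp_decay[OF _ that m])
    show "cmod (g x) \<le> B * exp (- m * \<bar>x\<bar>)" for x
      using decay(2)[of "\<bar>x\<bar>"] B by (simp add: g_def norm_mult abs_sgn_eq)
  qed measurable
  have h: "h \<in> L2_space \<Omega>" "(\<lambda>x. - h x) \<in> L2_space \<Omega>" if [measurable]: "\<Omega> \<in> sets borel" for \<Omega>
  proof -
    have "cmod (h x) \<le> C * exp (- m * \<bar>x\<bar>)" "cmod (- h x) \<le> C * exp (- m * \<bar>x\<bar>)" for x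
      using decay(3) by (simp_all add: h_def)
    then show "h \<in> L2_space \<Omega>" "(\<lambda>x. - h x) \<in> L2_space \<Omega>"
      by (auto intro!: L2_space_exp_decay[OF _ that m])
  qed
  have f': "(f has_vector_derivative g x) (at x)" if "x \<noteq> 0" for x
    unfolding f_def g_def using that \<Phi>
    by (intro has_vector_derivative_of_real has_real_derivative_even_extension) auto
  have g': "(g has_vector_derivative - h x) (at x)" if "x \<noteq> 0" for x
    using has_vector_derivative_of_real[OF has_real_derivative_odd_extension[OF that \<Psi>]]
    unfolding g_def h_def by simp
  have contg: "continuous_on (- {0}) g"
    using g' by (auto intro!: continuous_at_imp_continuous_on has_vector_derivative_continuous)
  \<comment> \<open>The kink of \<open>f\<close> at the origin is harmless because \<open>f\<close>
    is continuous there. In contrast, \<open>g\<close> may jump, so its derivative is taken only off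
    the origin.\<close>
  have w1: "weak_derivative UNIV f g"
    by (rule weak_derivativeI[where S = "{0}"]) (use f g contf f' in auto)
  have w2: "weak_derivative (- {0}) f g"
    by (rule weak_derivativeI[where S = "{}"])
       (use f g continuous_on_subset[OF contf] f' in auto)
  have w3: "weak_derivative (- {0}) g (\<lambda>x. - h x)"
    by (rule weak_derivativeI[where S = "{}"]) (use g h contg g' in auto)
  have "delta_jump_condition Z f"
    unfolding delta_jump_condition_def
  proof (intro exI conjI)
    \<comment> \<open>The continuous representative is \<open>f\<close> itself; the one-sided limits
      of its derivative are \<open>\<Psi> 0\<close> and \<open>- \<Psi> 0\<close>.\<close>
    show "continuous_on UNIV f" by (fact contf)
    have v: "vector_derivative f (at x) = of_real (sgn x * \<Psi> \<bar>x\<bar>)" if "x \<noteq> 0" for x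
      using vector_derivative_at[OF f'[OF that]] by (simp add: g_def)
    have lim: "((\<lambda>x. \<Psi> \<bar>x\<bar>) \<longlongrightarrow> \<Psi> 0) (at 0 within T)" for T
      using cont(2) continuous_on_def[of UNIV "\<lambda>x. \<Psi> \<bar>x\<bar>"] tendsto_within_subset[OF _ subset_UNIV]
      by (metis UNIV_I abs_zero)
    have "((\<lambda>x. of_real (\<Psi> \<bar>x\<bar>)) \<longlongrightarrow> complex_of_real (\<Psi> 0)) (at_right 0)"
      by (intro tendsto_of_real lim)
    then show "((\<lambda>x. vector_derivative f (at x)) \<longlongrightarrow> of_real (\<Psi> 0)) (at_right 0)"
      by (rule Lim_transform_eventually) (auto simp: eventually_at_filter v)
    have "((\<lambda>x. of_real (- \<Psi> \<bar>x\<bar>)) \<longlongrightarrow> complex_of_real (- \<Psi> 0)) (at_left 0)"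
      by (intro tendsto_of_real tendsto_minus lim)
    then show "((\<lambda>x. vector_derivative f (at x)) \<longlongrightarrow> of_real (- \<Psi> 0)) (at_left 0)"
      by (rule Lim_transform_eventually) (auto simp: eventually_at_filter v)
    show "complex_of_real (\<Psi> 0) - of_real (- \<Psi> 0) = - complex_of_real Z * f 0"
      using arg_cong[OF jump, of complex_of_real] by (simp add: f_def)
  qed simp
  moreover have "f \<in> sobolev_H 1 UNIV"
    using f g w1 by auto
  moreover have "g \<in> sobolev_H 1 (- {0})"
    using g h(2)[of "- {0}"] w3 by auto
  then have "f \<in> sobolev_H 2 (- {0})"
    using f w2 by (auto simp: numeral_2_eq_2)
  ultimately have "delta_operator Z f h"
    using g h(1) w2 w3 unfolding delta_operator_def delta_domain_def by auto
  then show ?thesis unfolding f_def h_def .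
qed

section \<open>Derivatives and growth of the profile\<close>

lemma powr_profile_derivs:
  fixes a b d p m :: real
  defines "q \<equiv> 1 / (p - 1)"
  defines "V \<equiv> \<lambda>y. a + b * sinh ((p - 1) * m * (y + d))"
  assumes p: "p > 1" and pos: "V y > 0"
  shows "((\<lambda>y. V y powr - q) has_real_derivative
            - (m * b * cosh ((p - 1) * m * (y + d)) * V y powr (- q - 1))) (at y)"
    and "((\<lambda>y. - (m * b * cosh ((p - 1) * m * (y + d)) * V y powr (- q - 1))) has_real_derivative
            m\<^sup>2 * (V y powr - q - (p + 1) * a * V y powr (- q - 1)
               + p * (a\<^sup>2 + b\<^sup>2) * V y powr (- q - 2))) (at y)"
proof -
  define k where "k = (p - 1) * m"
  define C where "C = cosh (k * (y + d))"
  define S where "S = sinh (k * (y + d))"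
  have qk: "q * k = m" using p by (simp add: q_def k_def)
  have V': "(V has_real_derivative b * (k * C)) (at y)"
    unfolding V_def k_def[symmetric] C_def by (auto intro!: derivative_eq_intros)
  have P: "((\<lambda>y. V y powr r) has_real_derivative r * V y powr (r - 1) * (b * (k * C))) (at y)" for r
    using has_real_derivative_powr[OF pos, of r] V' DERIV_chain2 by blast
  show "((\<lambda>y. V y powr - q) has_real_derivative
            - (m * b * cosh ((p - 1) * m * (y + d)) * V y powr (- q - 1))) (at y)"
  proof -
    have "- q * V y powr (- q - 1) * (b * (k * C)) = - (q * k * b * C * V y powr (- q - 1))"
      by (simp add: mult_ac)
    then show ?thesis
      using P[of "- q"] by (simp only: qk k_def[symmetric] C_def)
  qed
  have Cd: "((\<lambda>y. cosh (k * (y + d))) has_real_derivative k * S) (at y)"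
    unfolding S_def by (auto intro!: derivative_eq_intros)
  have "((\<lambda>y. - (m * b * cosh (k * (y + d)) * V y powr (- q - 1))) has_real_derivative
     - (m * b * (k * S) * V y powr (- q - 1)
      + (- q - 1) * V y powr (- q - 1 - 1) * (b * (k * C)) * (m * b * C))) (at y)"
    unfolding C_def[symmetric]
    by (rule DERIV_minus DERIV_mult DERIV_cmult Cd P derivative_eq_intros refl | simp add: C_def)+
  moreover have "- (m * b * (k * S) * V y powr (- q - 1)
      + (- q - 1) * V y powr (- q - 1 - 1) * (b * (k * C)) * (m * b * C))
     = m\<^sup>2 * (V y powr - q - (p + 1) * a * V y powr (- q - 1)
               + p * (a\<^sup>2 + b\<^sup>2) * V y powr (- q - 2))"
  proof -
    \<comment> \<open>Factoring out the lowest power leaves an identity between polynomials in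
      \<open>V y\<close>.\<close>
    define W where "W = V y powr (- q - 2)"
    have W: "V y powr (- q - 1) = V y * W" "V y powr - q = (V y)\<^sup>2 * W" "V y powr (- q - 1 - 1) = W"
    proof -
      show "V y powr (- q - 1) = V y * W" "V y powr - q = (V y)\<^sup>2 * W"
        using pos by (simp_all add: W_def powr_diff power2_eq_square)
      have "- q - 1 - 1 = - q - 2" by simp
      then show "V y powr (- q - 1 - 1) = W" by (simp only: W_def)
    qed
    have bS: "b * S = V y - a" by (simp add: V_def S_def k_def)
    \<comment> \<open>The identity \<open>cosh\<^sup>2 = sinh\<^sup>2 + 1\<close> eliminates the
      hyperbolic functions in favour of \<open>V y\<close>.\<close>
    have bC: "b\<^sup>2 * C\<^sup>2 = b\<^sup>2 + (V y - a)\<^sup>2"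
      using bS cosh_square_eq[of "k * (y + d)"]
      by (simp add: C_def S_def algebra_simps power_mult_distrib flip: bS)
    have qk1: "(q + 1) * k = p * m"
      using p by (simp add: q_def k_def field_simps)
    have "- (m * b * (k * S) * (V y * W) + (- q - 1) * W * (b * (k * C)) * (m * b * C))
        = m * W * (((q + 1) * k) * (b\<^sup>2 * C\<^sup>2) - k * (b * S) * V y)"
      by (simp add: power2_eq_square algebra_simps)
    also have "\<dots> = m * W * ((p * m) * (b\<^sup>2 + (V y - a)\<^sup>2) - (p - 1) * m * (V y - a) * V y)"
      unfolding bS bC qk1 by (simp add: k_def)
    also have "\<dots> = m\<^sup>2 * ((V y)\<^sup>2 * W - (p + 1) * a * (V y * W) + p * (a\<^sup>2 + b\<^sup>2) * W)"
      by (simp add: power2_eq_square algebra_simps)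
    finally show ?thesis by (simp only: W flip: W_def)
  qed
  ultimately show "((\<lambda>y. - (m * b * cosh ((p - 1) * m * (y + d)) * V y powr (- q - 1))) has_real_derivative
            m\<^sup>2 * (V y powr - q - (p + 1) * a * V y powr (- q - 1)
               + p * (a\<^sup>2 + b\<^sup>2) * V y powr (- q - 2))) (at y)"
    by (simp add: k_def)
qed

text \<open>In the addition formula for \<open>sinh (u + t)\<close> the term
  \<open>sinh u * cosh t\<close> is nonnegative, and \<open>a \<le> 0\<close> gives
  \<open>a * cosh u \<le> a\<close>. Hence \<open>(a + b * sinh t) * cosh u\<close> is a lower
  bound, and \<open>cosh u\<close> is at least \<open>exp u / 2\<close>.\<close>

lemma shifted_sinh_lower_bound:
  fixes a b t u :: real
  assumes "a \<le> 0" "b > 0" "u \<ge> 0" and nonneg: "a + b * sinh t \<ge> 0"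
  shows "(a + b * sinh t) / 2 * exp u \<le> a + b * sinh (u + t)"
proof -
  have "(a + b * sinh t) / 2 * exp u \<le> (a + b * sinh t) * cosh u"
    using nonneg mult_left_mono[of "exp u / 2" "cosh u" "a + b * sinh t"]
    by (simp add: cosh_def field_simps)
  also have "\<dots> = a * cosh u + b * (cosh u * sinh t)"
    by (simp add: algebra_simps)
  also have "\<dots> \<le> a * 1 + b * (cosh u * sinh t + sinh u * cosh t)"
    using assms cosh_real_ge_1[of u]
    by (intro add_mono mult_left_mono_neg mult_left_mono) (auto simp: cosh_real_nonneg)
  also have "\<dots> = a + b * sinh (u + t)"
    by (simp add: sinh_add)
  finally show ?thesis .
qed

lemma cosh_le_exp:
  fixes t :: real
  assumes "t \<ge> 0"
  shows "cosh t \<le> exp t"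
proof -
  have "exp (- t) \<le> exp t" using assms by simp
  then show ?thesis by (simp add: cosh_def field_simps)
qed

section \<open>The range and the domain of \<open>R1\<close>\<close>

lemma cosh_over_shifted_sinh_surj:
  fixes \<alpha> s c :: real
  assumes "s > 0" "\<alpha> \<le> 0" "c > 1"
  obtains t where "\<alpha> + s * sinh t > 0" "s * cosh t / (s * sinh t + \<alpha>) = c"
proof -
  \<comment> \<open>With the denominator cleared, the equation is a zero of a function that is
    continuous also at \<open>t0\<close>, where the denominator vanishes. The intermediate value
    theorem applies from \<open>t0\<close> onwards.\<close>
  define F where "F t = c * (s * sinh t + \<alpha>) - s * cosh t" for t
  define t0 where "t0 = arsinh (- \<alpha> / s)"
  \<comment> \<open>In exponentials, \<open>2 * F T / s\<close> is
    \<open>(c - 1) * exp T - (c + 1) * exp (- T) + 2 * c * \<alpha> / s\<close>. As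
    \<open>exp T \<ge> M\<close> and \<open>exp (- T) \<le> 1\<close> for \<open>T = t0 + M\<close>,
    this choice makes it nonnegative.\<close>
  define M where "M = (c + 1 - 2 * c * \<alpha> / s) / (c - 1)"
  have sinh_t0: "s * sinh t0 = - \<alpha>" using assms by (simp add: t0_def)
  have "sinh t0 \<ge> 0" using assms by (simp add: t0_def divide_nonpos_pos)
  then have t0: "t0 \<ge> 0" by simp
  have "c * \<alpha> / s \<le> 0" using assms by (simp add: divide_nonpos_pos mult_nonneg_nonpos)
  then have M: "M \<ge> 0" using assms by (simp add: M_def)
  have "F t0 \<le> 0"
    using assms cosh_real_pos[of t0] by (simp add: F_def sinh_t0)
  moreover have "0 \<le> F (t0 + M)"
  proof -
    define T where "T = t0 + M"
    have "M \<le> exp T" using exp_ge_add_one_self[of T] t0 unfolding T_def by linarith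
    then have "(c - 1) * M \<le> (c - 1) * exp T" using assms by simp
    moreover have "(c - 1) * M = c + 1 - 2 * c * \<alpha> / s" using assms by (simp add: M_def)
    moreover have "(c + 1) * exp (- T) \<le> (c + 1) * 1"
      using assms t0 M by (intro mult_left_mono) (auto simp: T_def)
    moreover have "2 * c * \<alpha> / s = 2 * (c * \<alpha> / s)" by simp
    ultimately have "0 \<le> (c - 1) * exp T - (c + 1) * exp (- T) + 2 * c * \<alpha> / s"
      using \<open>c * \<alpha> / s \<le> 0\<close> by argo
    then have "0 \<le> s / 2 * ((c - 1) * exp T - (c + 1) * exp (- T) + 2 * c * \<alpha> / s)"
      using assms by simp
    also have "\<dots> = F T"
      using assms by (simp add: F_def sinh_def cosh_def field_simps)
    finally show ?thesis by (simp add: T_def)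
  qed
  moreover have "continuous_on {t0..t0 + M} F"
    unfolding F_def by (intro continuous_intros)
  ultimately obtain t where t: "t0 \<le> t" "F t = 0"
    using IVT'[of F t0 0 "t0 + M"] M by auto
  \<comment> \<open>The zero is not \<open>t0\<close> itself, so the denominator is strictly
    positive there and division is legitimate.\<close>
  have "F t0 \<noteq> 0" using assms cosh_real_pos[of t0] by (simp add: F_def sinh_t0)
  with t have "t0 < t" by (cases "t = t0") auto
  then have "s * sinh t0 < s * sinh t" using assms by simp
  then have pos: "\<alpha> + s * sinh t > 0" using sinh_t0 by simp
  with t(2) have "s * cosh t / (s * sinh t + \<alpha>) = c"
    by (simp add: F_def field_simps)
  with pos show ?thesis by (rule that)
qed

text \<open>The left endpoint of the domain is the zero of the denominator of \<open>R1\<close>, and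
  \<open>sinh\<close> is strictly increasing.\<close>

lemma l_shift_less_iff:
  assumes "p > 1" "\<omega> < 0" "sqrt_discr p lam1 lam2 \<omega> > 0"
  shows "- l_shift p lam1 lam2 \<omega> < d \<longleftrightarrow>
    0 < alpha_coeff p lam1 + sqrt_discr p lam1 lam2 \<omega> * sinh ((p - 1) * sqrt (- \<omega>) * d)"
proof -
  let ?k = "(p - 1) * sqrt (- \<omega>)"
  let ?x = "alpha_coeff p lam1 / sqrt_discr p lam1 lam2 \<omega>"
  have k: "?k > 0" using assms by simp
  have "- l_shift p lam1 lam2 \<omega> < d \<longleftrightarrow> arsinh (- ?x) < ?k * d"
    using k by (simp add: l_shift_def arsinh_minus_real minus_less_iff field_simps)
  also have "\<dots> \<longleftrightarrow> sinh (arsinh (- ?x)) < sinh (?k * d)"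
    by (simp only: sinh_real_less_iff)
  also have "\<dots> \<longleftrightarrow> - ?x < sinh (?k * d)" by (simp only: sinh_arsinh_real)
  also have "\<dots> \<longleftrightarrow> 0 < alpha_coeff p lam1 + sqrt_discr p lam1 lam2 \<omega> * sinh (?k * d)"
    using pos_divide_less_eq[OF assms(3), of "- alpha_coeff p lam1" "sinh (?k * d)"]
    by (auto simp: mult.commute)
  finally show ?thesis .
qed

section \<open>The profile in the domain of the operator\<close>

lemma delta_operator_powr_profile:
  fixes a b d p m Z :: real
  defines "q \<equiv> 1 / (p - 1)"
  defines "V \<equiv> \<lambda>y. a + b * sinh ((p - 1) * m * (y + d))"
  assumes p: "p > 1" and m: "m > 0" and a: "a \<le> 0" and b: "b > 0" and V0: "V 0 > 0"
    and jump: "2 * m * b * cosh ((p - 1) * m * d) = Z * V 0"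
  shows "delta_operator Z (\<lambda>x. of_real (V \<bar>x\<bar> powr - q))
    (\<lambda>x. of_real (- (m\<^sup>2 * (V \<bar>x\<bar> powr - q - (p + 1) * a * V \<bar>x\<bar> powr (- q - 1)
               + p * (a\<^sup>2 + b\<^sup>2) * V \<bar>x\<bar> powr (- q - 2)))))"
proof -
  define k where "k = (p - 1) * m"
  \<comment> \<open>The constant of \<open>shifted_sinh_lower_bound\<close> with
    \<open>t = k * d\<close> and \<open>u = k * y\<close>.\<close>
  define c where "c = V 0 / 2"
  define X where "X y = m\<^sup>2 * (V y powr - q - (p + 1) * a * V y powr (- q - 1)
               + p * (a\<^sup>2 + b\<^sup>2) * V y powr (- q - 2))" for y
  have c: "c > 0" using V0 by (simp add: c_def)
  have k: "k > 0" using p m by (simp add: k_def)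
  have q: "q > 0" using p by (simp add: q_def)
  have kq: "k * q = m" using p by (simp add: k_def q_def)
  have V: "V y = a + b * sinh (k * (y + d))" for y by (simp add: V_def k_def)
  \<comment> \<open>From \<open>a \<le> 0\<close> and \<open>V 0 > 0\<close> the shift
    \<open>d\<close> is positive, which allows the bound of \<open>cosh\<close> by
    \<open>exp\<close> on the half-line.\<close>
  have "b * sinh (k * d) > 0" using V0 a by (simp add: V)
  then have kd: "k * d > 0" using b by (simp add: zero_less_mult_iff)
  then have d: "d > 0" using k by (simp add: zero_less_mult_iff)
  have lower: "c * exp (k * y) \<le> V y" if "y \<ge> 0" for y
    using shifted_sinh_lower_bound[of a b "k * y" "k * d"] a b that k V0
    by (simp add: V c_def ring_distribs)
  have c_le: "c \<le> V y" if "y \<ge> 0" for y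
  proof -
    have "c * 1 \<le> c * exp (k * y)" using that c k by (intro mult_left_mono) auto
    with lower[OF that] show ?thesis by simp
  qed
  have pos: "V y > 0" if "y \<ge> 0" for y using c_le[OF that] c by simp
  have decay: "V y powr - q \<le> c powr - q * exp (- m * y)" if "y \<ge> 0" for y
  proof -
    have "V y powr - q \<le> (c * exp (k * y)) powr - q"
      using q lower[OF that] c by (intro powr_mono2') auto
    also have "\<dots> = c powr - q * exp (- m * y)"
      using c by (simp add: powr_mult exp_powr_real flip: kq)
    finally show ?thesis .
  qed
  \<comment> \<open>Each derivative becomes \<open>V y powr - q\<close>, which decays at rate
    \<open>k * q = m\<close>, times a factor that remains to be bounded.\<close>
  have shift: "V y powr (- q - 1) = V y powr - q / V y" "V y powr (- q - 2) = V y powr - q / (V y)\<^sup>2"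
    if "y \<ge> 0" for y
    using pos[OF that] by (simp_all add: powr_diff)
  show ?thesis
    unfolding X_def[symmetric]
  proof (rule delta_operator_even_extension)
    fix y :: real assume y: "y \<ge> 0"
    show "((\<lambda>y. V y powr - q) has_real_derivative - (m * b * cosh (k * (y + d)) * V y powr (- q - 1))) (at y)"
      using powr_profile_derivs(1)[OF p, of a b m y d] pos[OF y] by (simp add: V q_def k_def)
    show "((\<lambda>y. - (m * b * cosh (k * (y + d)) * V y powr (- q - 1))) has_real_derivative X y) (at y)"
      using powr_profile_derivs(2)[OF p, of a b m y d] pos[OF y] unfolding X_def by (simp add: V q_def k_def)
    show "\<bar>V y powr - q\<bar> \<le> c powr - q * exp (- m * y)" using decay[OF y] by simp
    have "cosh (k * (y + d)) \<le> exp (k * (y + d))" using y d k by (intro cosh_le_exp) auto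
    also have "\<dots> = exp (k * d) / c * (c * exp (k * y))"
      using c by (simp add: exp_add[symmetric] ring_distribs add.commute)
    also have "\<dots> \<le> exp (k * d) / c * V y"
      using c lower[OF y] by (intro mult_left_mono) auto
    finally have "cosh (k * (y + d)) / V y \<le> exp (k * d) / c"
      using pos[OF y] by (simp add: pos_divide_le_eq)
    then have "m * b * (cosh (k * (y + d)) / V y) * V y powr - q
        \<le> m * b * (exp (k * d) / c) * (c powr - q * exp (- m * y))"
      using m b c decay[OF y] by (intro mult_mono mult_left_mono) auto
    moreover have "\<bar>- (m * b * cosh (k * (y + d)) * V y powr (- q - 1))\<bar>
        = m * b * (cosh (k * (y + d)) / V y) * V y powr - q"
      using m b pos[OF y] by (simp add: shift[OF y] abs_mult cosh_real_nonneg)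
    ultimately show "\<bar>- (m * b * cosh (k * (y + d)) * V y powr (- q - 1))\<bar>
        \<le> (m * b * (exp (k * d) / c) * c powr - q) * exp (- m * y)"
      by (simp add: mult.assoc)
    \<comment> \<open>As \<open>a \<le> 0\<close>, both terms are nonnegative and decreasing in
      \<open>V y\<close>, so replacing \<open>V y\<close> by its lower bound \<open>c\<close> bounds
      the factor.\<close>
    have "- ((p + 1) * a) / V y \<le> - ((p + 1) * a) / c"
      using a p c c_le[OF y] by (intro divide_left_mono) (auto simp: mult_nonneg_nonpos)
    moreover have "p * (a\<^sup>2 + b\<^sup>2) / (V y)\<^sup>2 \<le> p * (a\<^sup>2 + b\<^sup>2) / c\<^sup>2"
      using p c c_le[OF y] by (intro divide_left_mono power_mono) auto
    ultimately have "1 - (p + 1) * a / V y + p * (a\<^sup>2 + b\<^sup>2) / (V y)\<^sup>2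
        \<le> 1 - (p + 1) * a / c + p * (a\<^sup>2 + b\<^sup>2) / c\<^sup>2" (is "?l \<le> ?r")
      by simp
    moreover have "0 \<le> - ((p + 1) * a) / V y" "0 \<le> p * (a\<^sup>2 + b\<^sup>2) / (V y)\<^sup>2"
      using a p pos[OF y] by (auto simp: divide_nonpos_pos mult_nonneg_nonpos)
    then have "0 \<le> ?l" by simp
    ultimately have "m\<^sup>2 * ?l * V y powr - q \<le> m\<^sup>2 * ?r * (c powr - q * exp (- m * y))"
      using decay[OF y] by (intro mult_mono mult_left_mono) auto
    moreover have "X y = m\<^sup>2 * ?l * V y powr - q"
      by (simp add: X_def shift[OF y] algebra_simps add_divide_distrib)
    ultimately show "\<bar>X y\<bar> \<le> (m\<^sup>2 * ?r * c powr - q) * exp (- m * y)"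
      using \<open>0 \<le> ?l\<close> by (simp add: mult.assoc)
  next
    have "continuous_on {0..} V" unfolding V by (intro continuous_intros)
    then show "continuous_on {0..} X"
      unfolding X_def by (intro continuous_intros) (use pos in force)+
    \<comment> \<open>Multiplying the hypothesis \<open>jump\<close> by
      \<open>V 0 powr (- q - 1)\<close> gives the jump condition for the power.\<close>
    have "V 0 powr (- q - 1) * V 0 = V 0 powr - q" using shift(1)[of 0] V0 by simp
    with jump have "2 * m * b * cosh (k * d) * V 0 powr (- q - 1) = Z * V 0 powr - q"
      by (simp add: k_def mult_ac)
    then show "2 * - (m * b * cosh (k * (0 + d)) * V 0 powr (- q - 1)) = - Z * V 0 powr - q"
      by simp
  qed (fact m)
qed

section \<open>The stationary equation for the profile\<close>

theorem theorem3p5: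
  fixes p lam1 lam2 Z \<omega> :: real
  assumes "p > 1" and "lam1 \<le> 0" and "lam2 < 0" and "Z > 0"
    and "\<omega> < 0"
    and "- (p * lam1\<^sup>2 / ((p + 1)\<^sup>2 * lam2)) < - \<omega>" and "- \<omega> < Z\<^sup>2 / 4"
  shows "standing_wave_solution Z p lam1 lam2 \<omega>
           (\<lambda>x t. exp (- \<i> * of_real \<omega> * of_real t) * of_real (profile Z p lam1 lam2 \<omega> x))"
proof -
  define \<alpha> where "\<alpha> = alpha_coeff p lam1"
  define s where "s = sqrt_discr p lam1 lam2 \<omega>"
  define m where "m = sqrt (- \<omega>)"
  define q where "q = 1 / (p - 1)"
  define a where "a = \<alpha> / m\<^sup>2"
  define b where "b = s / m\<^sup>2"
  define d where "d = inv_into {- l_shift p lam1 lam2 \<omega> <..} (R1 p lam1 lam2 \<omega>) (Z / (2 * m))"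
  define V where "V y = a + b * sinh ((p - 1) * m * (y + d))" for y
  have m: "m > 0" and m2: "m\<^sup>2 = - \<omega>" using \<open>\<omega> < 0\<close> by (simp_all add: m_def)
  have lam1: "lam1 = (p + 1) * \<alpha>" using \<open>p > 1\<close> by (simp add: \<alpha>_def alpha_coeff_def)
  \<comment> \<open>The lower bound on \<open>- \<omega>\<close> says exactly that the discriminant
    under the root in \<open>s\<close> is positive.\<close>
  have "\<alpha>\<^sup>2 < \<omega> * (lam2 / p)"
    using assms by (simp add: lam1 power_mult_distrib divide_simps) (simp add: mult_ac)
  then have s: "s > 0" and s2: "s\<^sup>2 = \<omega> * (lam2 / p) - \<alpha>\<^sup>2"
    by (simp_all add: s_def sqrt_discr_def beta_coeff_def \<alpha>_def)
  have \<alpha>: "\<alpha> \<le> 0" using assms by (simp add: \<alpha>_def alpha_coeff_def divide_nonpos_pos)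
  \<comment> \<open>The upper bound on \<open>- \<omega>\<close> puts the value to be inverted into
    the range of \<open>R1\<close>.\<close>
  have c: "Z / (2 * m) > 1"
  proof -
    have "(2 * m)\<^sup>2 < Z\<^sup>2" using \<open>- \<omega> < Z\<^sup>2 / 4\<close> by (simp add: power_mult_distrib m2)
    then have "2 * m < Z" using \<open>Z > 0\<close> by (auto intro: power2_less_imp_less)
    with m show ?thesis by simp
  qed
  have R1: "R1 p lam1 lam2 \<omega> x = s * cosh ((p - 1) * m * x) / (s * sinh ((p - 1) * m * x) + \<alpha>)" for x
    by (simp add: R1_def s_def m_def \<alpha>_def)
  have shift: "- l_shift p lam1 lam2 \<omega> < x \<longleftrightarrow> 0 < \<alpha> + s * sinh ((p - 1) * m * x)" for x
    using l_shift_less_iff \<open>p > 1\<close> \<open>\<omega> < 0\<close> s by (simp add: s_def m_def \<alpha>_def)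
  obtain t where t: "\<alpha> + s * sinh t > 0" "s * cosh t / (s * sinh t + \<alpha>) = Z / (2 * m)"
    using cosh_over_shifted_sinh_surj[OF s \<alpha> c] .
  have "(p - 1) * m * (t / ((p - 1) * m)) = t" using \<open>p > 1\<close> m by simp
  with t have "t / ((p - 1) * m) \<in> {- l_shift p lam1 lam2 \<omega> <..}"
    "R1 p lam1 lam2 \<omega> (t / ((p - 1) * m)) = Z / (2 * m)"
    by (simp_all only: greaterThan_iff shift R1)
  \<comment> \<open>Having a preimage in the domain, the value is genuinely inverted by
    \<open>inv_into\<close>: \<open>d\<close> lies in the domain and \<open>R1\<close> maps it to
    \<open>Z / (2 * m)\<close>.\<close>
  then have im: "Z / (2 * m) \<in> R1 p lam1 lam2 \<omega> ` {- l_shift p lam1 lam2 \<omega> <..}"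
    by (metis imageI)
  have d_pos: "0 < \<alpha> + s * sinh ((p - 1) * m * d)"
    using inv_into_into[OF im] shift by (simp add: d_def)
  have d_R1: "s * cosh ((p - 1) * m * d) / (s * sinh ((p - 1) * m * d) + \<alpha>) = Z / (2 * m)"
    using f_inv_into_f[OF im] by (simp add: R1 d_def)
  have V_eq: "m\<^sup>2 * V y = \<alpha> + s * sinh ((p - 1) * m * (y + d))" for y
    using m by (simp add: V_def a_def b_def field_simps)
  have V0: "V 0 > 0"
    using V_eq[of 0] d_pos zero_less_mult_pos[of "m\<^sup>2" "V 0"] m by simp
  have profile: "profile Z p lam1 lam2 \<omega> x = V \<bar>x\<bar> powr - q" for x
    by (simp add: profile_def V_def a_def b_def d_def q_def m2 flip: \<alpha>_def s_def m_def)
  \<comment> \<open>The denominator of \<open>R1\<close> at \<open>d\<close> is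
    \<open>m\<^sup>2 * V 0\<close>; clearing it turns the equation for \<open>d\<close> into the
    jump condition.\<close>
  have "2 * m * (s * cosh ((p - 1) * m * d)) = Z * (m\<^sup>2 * V 0)"
    using d_R1 d_pos m unfolding V_eq add_0 by (simp add: field_simps)
  then have jump: "2 * m * b * cosh ((p - 1) * m * d) = Z * V 0"
    using m by (simp add: b_def field_simps)
  have "a \<le> 0" "b > 0" using \<alpha> s m by (simp_all add: a_def b_def divide_nonpos_pos)
  note op = delta_operator_powr_profile[OF \<open>p > 1\<close> m this, of d Z, folded V_def q_def, OF V0 jump]
  \<comment> \<open>Here \<open>\<alpha>\<^sup>2 + s\<^sup>2 = \<omega> * lam2 / p\<close>, so the
    coefficient of the lowest power is the quintic-type coefficient up to sign.\<close>
  have m4: "m\<^sup>2 * (p * (a\<^sup>2 + b\<^sup>2)) = - lam2"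
  proof -
    have "m\<^sup>2 * (p * (a\<^sup>2 + b\<^sup>2)) = p * (\<alpha>\<^sup>2 + s\<^sup>2) / m\<^sup>2"
      using m by (simp add: a_def b_def field_simps)
    also have "\<dots> = - lam2" using \<open>p > 1\<close> \<open>\<omega> < 0\<close> by (simp add: s2 m2)
    finally show ?thesis .
  qed
  have m2a: "m\<^sup>2 * ((p + 1) * a) = lam1" using m by (simp add: lam1 a_def)
  have pos: "V \<bar>x\<bar> > 0" for x
  proof -
    have "sinh ((p - 1) * m * (0 + d)) \<le> sinh ((p - 1) * m * (\<bar>x\<bar> + d))"
      using \<open>p > 1\<close> m by simp
    then have "V 0 \<le> V \<bar>x\<bar>" using \<open>b > 0\<close> unfolding V_def by simp
    with V0 show ?thesis by simp
  qed
  have ode: "- (m\<^sup>2 * (v powr - q - (p + 1) * a * v powr (- q - 1) + p * (a\<^sup>2 + b\<^sup>2) * v powr (- q - 2)))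
      - \<omega> * v powr - q - lam1 * v powr - q * (v powr - q) powr (p - 1)
      - lam2 * v powr - q * (v powr - q) powr (2 * p - 2) = 0" if "v > 0" for v
  proof -
    \<comment> \<open>Since \<open>q * (p - 1) = 1\<close>, the two nonlinear factors are
      \<open>v powr - 1\<close> and \<open>v powr - 2\<close>, matching the powers in the second
      derivative.\<close>
    have qp: "- q * (p - 1) = - 1" "- q * (2 * p - 2) = - 2"
      using \<open>p > 1\<close> by (simp_all add: q_def divide_simps)
    have "v powr - q * (v powr - q) powr (p - 1) = v powr (- q - 1)"
      "v powr - q * (v powr - q) powr (2 * p - 2) = v powr (- q - 2)"
      unfolding powr_powr qp powr_add[symmetric] by simp_all
    then have *: "lam1 * v powr - q * (v powr - q) powr (p - 1) = m\<^sup>2 * ((p + 1) * a) * v powr (- q - 1)"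
      "lam2 * v powr - q * (v powr - q) powr (2 * p - 2) = - (m\<^sup>2 * (p * (a\<^sup>2 + b\<^sup>2))) * v powr (- q - 2)"
      by (simp_all add: m2a m4 mult.assoc)
    have "\<omega> = - m\<^sup>2" using m2 by simp
    then show ?thesis unfolding * by (simp add: algebra_simps)
  qed
  have "stationary_solution Z p lam1 lam2 \<omega> (\<lambda>x. of_real (profile Z p lam1 lam2 \<omega> x))"
    unfolding stationary_solution_def profile
    \<comment> \<open>The rule \<open>op\<close> supplies the witness \<open>h\<close>; the modulus
      of the profile is its value because \<open>powr\<close> is nonnegative.\<close>
    by (intro exI conjI, rule op)
       (use arg_cong[OF ode[OF pos], of complex_of_real] in simp)
  then show ?thesis
    unfolding standing_wave_solution_def
    by (intro exI[of _ "\<lambda>x. of_real (profile Z p lam1 lam2 \<omega> x)"]) simp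
qed

end
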